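(* Let $f:\mathbb{R}\to\mathbb{R}$ be continuously differentiable, let $\alpha\in(0,1]$, $p>0$, $\mu>0$, and suppose $f$ is $(\mu,p)$-uniformly convex. Then for all $x,c\in\mathbb{R}$ with $x\neq c$, $$\frac{f'(x)(x-c)}{\Gamma(2-\alpha)|x-c|^{\alpha}}-{}^{C}D^{\alpha}_{c}f(x)\ge\frac{\mu}{\Gamma(1-\alpha)(1+p-\alpha)}|x-c|^{1+p-\alpha}.$$
   Context: $f:\mathbb{R}\to\mathbb{R}$ is $(\mu,p)$-uniformly convex ($p>0$) if $f(y)-f(x)-f'(x)(y-x)\ge\frac{\mu}{1+p}|y-x|^{1+p}$ for all $x,y\in\mathbb{R}$. $\Gamma$ is the gamma function. For $0<\alpha<1$ and $x\ne c$ (either $x>c$ or $x<c$), the Caputo derivative of order $\alpha$ with terminal $c$ is $${}^{C}D^{\alpha}_{c}f(x)=\frac{1}{\Gamma(1-\alpha)}\int_c^x\frac{f'(t)}{|x-t|^{\alpha}}\,dt,$$ where $\int_c^x$ is the oriented integral. Convention at $\alpha=1$: ${}^{C}D^{1}_{c}f(x)$ is the limiting value $\operatorname{sgn}(x-c)f'(x)$, where $\operatorname{sgn}$ is the sign function, and $1/\Gamma(1-\alpha)=1/\Gamma(0)$ is read as $0$. *)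

theory Defs
  imports "HOL-Analysis.Analysis"
begin

definition uniformly_convex :: "real \<Rightarrow> real \<Rightarrow> (real \<Rightarrow> real) \<Rightarrow> bool" where
  "uniformly_convex \<mu> p f \<longleftrightarrow>
     (\<forall>x y. f y - f x - deriv f x * (y - x) \<ge> \<mu> / (1 + p) * \<bar>y - x\<bar> powr (1 + p))"

text \<open>
  The Caputo derivative \<open>caputo_deriv \<alpha> c f x\<close> of order \<open>\<alpha>\<close> with terminal \<open>c\<close>, evaluated at
  \<open>x\<close>, for \<open>0 < \<alpha> \<le> 1\<close> and \<open>x \<noteq> c\<close> on either side. The interval integral is oriented: it changes
  sign when the endpoints are swapped. Its order-one value is the limit as \<open>\<alpha>\<close> tends to 1 from
  below. Reciprocals of Gamma are written with the entire function \<open>rGamma\<close>, which is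
  \<open>1 / Gamma\<close> away from the poles and 0 at them, so that \<open>rGamma 0 = 0\<close> is the intended
  reading of \<open>1 / \<Gamma>(1 - \<alpha>)\<close> at \<open>\<alpha> = 1\<close>.
\<close>

definition caputo_deriv :: "real \<Rightarrow> real \<Rightarrow> (real \<Rightarrow> real) \<Rightarrow> real \<Rightarrow> real" where
  "caputo_deriv \<alpha> c f x =
     (if \<alpha> = 1 then sgn (x - c) * deriv f x
      else rGamma (1 - \<alpha>) * (LBINT t=c..x. deriv f t / \<bar>x - t\<bar> powr \<alpha>))"

end

theory Submission
  imports Defs
begin

text \<open>
  For \<open>\<alpha> < 1\<close> put \<open>L = \<bar>x - c\<bar>\<close> and \<open>\<sigma> = sgn (c - x)\<close>, and let
  \<open>g s = f (x + \<sigma> s) - f x - \<sigma> s f' x\<close> be the gap between \<open>f\<close> and its tangent at \<open>x\<close>, as seen when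
  walking from \<open>x\<close> towards \<open>c\<close>. The kernel \<open>s\<^sup>-\<^sup>\<alpha>\<close> has integral \<open>L powr (1 - \<alpha>) / (1 - \<alpha>)\<close> over
  \<open>{0..L}\<close> and \<open>\<Gamma>(2 - \<alpha>) = (1 - \<alpha>) \<Gamma>(1 - \<alpha>)\<close>, so the left-hand side of the theorem is exactly
  \<open>1 / \<Gamma>(1 - \<alpha>)\<close> times the weakly singular integral of \<open>g' s * s powr - \<alpha>\<close> over \<open>{0..L}\<close>, on either
  side of \<open>c\<close>.

  Uniform convexity says \<open>g s \<ge> m s powr (1 + p)\<close> with \<open>m = \<mu> / (1 + p)\<close>. Formally, integration by
  parts turns the integral into \<open>g L * L powr - \<alpha>\<close> plus \<open>\<alpha>\<close> times the integral of
  \<open>g s * s powr (- \<alpha> - 1)\<close>. Both terms increase with \<open>g\<close>, and inserting the lower bound for \<open>g\<close> gives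
  \<open>m (1 + \<alpha> / (1 + p - \<alpha>)) L powr (1 + p - \<alpha>)\<close>, which is the right-hand side. Lemma
  \<open>weakly_singular_integral_lower_bound\<close> carries this out by a monotonicity argument,
  so that the second, more singular integral never has to be formed.

  At \<open>\<alpha> = 1\<close> both sides vanish.
\<close>

text \<open>
  A bounded measurable factor keeps the integrable kernel \<open>s powr - \<alpha>\<close> absolutely integrable. The
  Borel measurability of the product is what lowers this from \<open>lebesgue\<close> to \<open>lborel\<close>, the measure
  behind the Caputo derivative.
\<close>
lemma weakly_singular_set_integrable:
  fixes u :: "real \<Rightarrow> real"
  assumes u: "continuous_on {0..L} u" and "\<alpha> < 1" "0 \<le> L"
  shows "set_integrable lborel {0..L} (\<lambda>s. u s * s powr - \<alpha>)"
proof -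
  have "(\<lambda>s. s powr - \<alpha>) integrable_on {0..L}"
    using has_integral_powr_from_0[of "- \<alpha>" L] assms by (auto simp: integrable_on_def)
  then have kernel: "(\<lambda>s. s powr - \<alpha>) absolutely_integrable_on {0..L}"
    by (rule nonnegative_absolutely_integrable_1) simp
  have "(\<lambda>s. u s * s powr - \<alpha>) absolutely_integrable_on {0..L}"
    by (rule absolutely_integrable_bounded_measurable_product_real[OF _ _ _ kernel])
       (auto intro!: continuous_imp_measurable_on_sets_lebesgue u compact_imp_bounded
          compact_continuous_image)
  moreover have "(\<lambda>s. (indicator {0..L} s *\<^sub>R u s) * s powr - \<alpha>) \<in> borel_measurable borel"
    by (intro borel_measurable_times borel_measurable_continuous_on_indicator u) auto
  ultimately show ?thesis
    unfolding set_integrable_def by (simp add: integrable_completion mult.assoc)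
qed

text \<open>
  The conclusion is what integration by parts predicts from \<open>g s \<ge> m s powr q\<close>. Subtracting from
  the integral up to \<open>r\<close> the boundary term \<open>g r * r powr - \<alpha>\<close> leaves a function of \<open>r\<close> whose derivative
  is \<open>\<alpha> g r * r powr (- \<alpha> - 1) \<ge> \<alpha> m r powr (q - \<alpha> - 1)\<close>. The lower bound is the derivative of
  \<open>\<alpha> m / (q - \<alpha>) * r powr (q - \<alpha>)\<close>, so the difference \<open>K\<close> of the two is nondecreasing, and it
  starts at 0. The boundary term vanishes at the singular end because \<open>g\<close> is differentiable at 0
  with \<open>g 0 = 0\<close>, hence \<open>g r = O(r)\<close>, and \<open>\<alpha> < 1\<close>. At \<open>r = L\<close> the boundary term is itself at
  least \<open>m L powr (q - \<alpha>)\<close>, and the two contributions add up because \<open>1 + \<alpha> / (q - \<alpha>) = q / (q - \<alpha>)\<close>.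
\<close>
lemma weakly_singular_integral_lower_bound:
  fixes g g' :: "real \<Rightarrow> real"
  assumes deriv: "\<And>s. s \<in> {0..L} \<Longrightarrow> (g has_real_derivative g' s) (at s within {0..L})"
    and cont: "continuous_on {0..L} g'"
    and g0: "g 0 = 0"
    and lower: "\<And>s. s \<in> {0..L} \<Longrightarrow> m * s powr q \<le> g s"
    and "0 < \<alpha>" "\<alpha> < 1" "\<alpha> < q" "0 < L"
  shows "m * q / (q - \<alpha>) * L powr (q - \<alpha>) \<le> integral {0..L} (\<lambda>s. g' s * s powr - \<alpha>)"
proof -
  let ?\<phi> = "\<lambda>s. g' s * s powr - \<alpha>"
  define K where "K r = integral {0..r} ?\<phi> - g r * r powr - \<alpha>
      - \<alpha> * m / (q - \<alpha>) * r powr (q - \<alpha>)" for r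
  have int: "?\<phi> integrable_on {0..L}"
    using \<open>\<alpha> < 1\<close> \<open>0 < L\<close>
    by (intro set_borel_integral_eq_integral(1) weakly_singular_set_integrable cont) auto
  have cont_g: "continuous_on {0..L} g"
    by (rule DERIV_continuous_on) (rule deriv)
  have boundary: "continuous_on {0..L} (\<lambda>r. g r * r powr - \<alpha>)"
    unfolding continuous_on_eq_continuous_within
  proof
    fix r assume r: "r \<in> {0..L}"
    show "continuous (at r within {0..L}) (\<lambda>r. g r * r powr - \<alpha>)"
    proof (cases "r = 0")
      case True
      have "((\<lambda>y. (g y - g 0) / (y - 0)) \<longlongrightarrow> g' 0) (at 0 within {0..L})"
        using deriv[of 0] \<open>0 < L\<close> by (simp add: has_field_derivative_iff)
      \<comment> \<open>near 0, write the boundary term as the difference quotient of \<open>g\<close> times a vanishing power\<close>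
      moreover have "((\<lambda>y. y powr (1 - \<alpha>)) \<longlongrightarrow> 0 powr (1 - \<alpha>)) (at 0 within {0..L})"
        using \<open>\<alpha> < 1\<close> by (intro tendsto_powr2 tendsto_intros)
          (auto simp: eventually_at intro!: exI[of _ 1])
      ultimately have "((\<lambda>y. (g y - g 0) / (y - 0) * y powr (1 - \<alpha>)) \<longlongrightarrow> g' 0 * 0 powr (1 - \<alpha>))
          (at 0 within {0..L})"
        by (rule tendsto_mult)
      then have "((\<lambda>y. (g y - g 0) / (y - 0) * y powr (1 - \<alpha>)) \<longlongrightarrow> 0) (at 0 within {0..L})"
        by simp
      then have "((\<lambda>y. g y * y powr - \<alpha>) \<longlongrightarrow> 0) (at 0 within {0..L})"
      proof (rule Lim_transform_eventually)
        show "\<forall>\<^sub>F y in at 0 within {0..L}.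
            (g y - g 0) / (y - 0) * y powr (1 - \<alpha>) = g y * y powr - \<alpha>"
          unfolding eventually_at
          by (rule exI[of _ 1]) (auto simp: g0 powr_diff powr_minus field_simps)
      qed
      then show ?thesis
        by (simp add: True continuous_within g0)
    next
      case False
      then show ?thesis
        using r cont_g by (intro continuous_intros)
          (auto simp: continuous_on_eq_continuous_within)
    qed
  qed
  have "K 0 \<le> K L"
  proof (rule DERIV_nonneg_imp_increasing_open[where f = K])
    show "continuous_on {0..L} K"
      unfolding K_def using \<open>\<alpha> < q\<close>
      by (intro continuous_on_diff boundary indefinite_integral_continuous_1 int
          continuous_on_mult continuous_on_const continuous_on_powr' continuous_on_id) auto
  next
    fix r assume r: "0 < r" "r < L"
    have interior: "at r within {0..L} = at r"
      using r by (intro at_within_interior) auto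
    have dg: "(g has_real_derivative g' r) (at r)"
      using deriv[of r] r interior by simp
    have "((\<lambda>u. integral {0..u} ?\<phi>) has_vector_derivative ?\<phi> r) (at r within {0..L} - {})"
      using r continuous_on_interior[OF cont, of r]
      by (intro integral_has_vector_derivative_continuous_at int)
         (auto intro!: continuous_intros simp: interior)
    then have dI: "((\<lambda>u. integral {0..u} ?\<phi>) has_real_derivative ?\<phi> r) (at r)"
      by (simp add: interior has_real_derivative_iff_has_vector_derivative)
    have "(K has_real_derivative ?\<phi> r - (g' r * r powr - \<alpha> + (- \<alpha> * r powr (- \<alpha> - 1)) * g r)
        - \<alpha> * m / (q - \<alpha>) * ((q - \<alpha>) * r powr (q - \<alpha> - 1))) (at r)"
      unfolding K_def using r
      by (intro DERIV_diff DERIV_mult dI dg DERIV_cmult has_real_derivative_powr) auto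
    moreover have "m * r powr (q - \<alpha> - 1) \<le> g r * r powr (- \<alpha> - 1)"
      using mult_right_mono[OF lower[of r], of "r powr (- \<alpha> - 1)"] r
      by (simp add: mult.assoc algebra_simps flip: powr_add)
    then have "\<alpha> * (m * r powr (q - \<alpha> - 1)) \<le> \<alpha> * (g r * r powr (- \<alpha> - 1))"
      using \<open>0 < \<alpha>\<close> by (intro mult_left_mono) auto
    then have "0 \<le> ?\<phi> r - (g' r * r powr - \<alpha> + (- \<alpha> * r powr (- \<alpha> - 1)) * g r)
        - \<alpha> * m / (q - \<alpha>) * ((q - \<alpha>) * r powr (q - \<alpha> - 1))"
      using \<open>\<alpha> < q\<close> by (simp add: mult_ac)
    ultimately show "\<exists>y. (K has_real_derivative y) (at r) \<and> 0 \<le> y"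
      by blast
  qed (use \<open>0 < L\<close> in simp)
  moreover have "K 0 = 0"
    by (simp add: K_def)
  moreover have "m * L powr (q - \<alpha>) \<le> g L * L powr - \<alpha>"
    using mult_right_mono[OF lower[of L], of "L powr - \<alpha>"] \<open>0 < L\<close>
    by (simp add: mult.assoc flip: powr_add)
  moreover have "m * q / (q - \<alpha>) * L powr (q - \<alpha>)
      = m * L powr (q - \<alpha>) + \<alpha> * m / (q - \<alpha>) * L powr (q - \<alpha>)"
    using \<open>\<alpha> < q\<close> by (simp add: field_simps)
  ultimately show ?thesis
    unfolding K_def by linarith
qed

text \<open>
  Measuring the distance \<open>s\<close> from \<open>x\<close> towards \<open>c\<close> moves the singular point to 0 and treats the
  cases \<open>x > c\<close> and \<open>x < c\<close> at once: the sign in front absorbs the orientation of the integral.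
\<close>
lemma oriented_integral_from_endpoint:
  fixes h :: "real \<Rightarrow> real"
  assumes "x \<noteq> c"
  shows "(LBINT t=c..x. h t)
    = - sgn (c - x) * (LBINT s=0..ereal \<bar>x - c\<bar>. h (x + sgn (c - x) * s))"
proof -
  have sub: "(LBINT t. indicator A t *\<^sub>R h t)
      = (LBINT s. indicator A (x + sgn (c - x) * s) *\<^sub>R h (x + sgn (c - x) * s))" for A
    using assms lborel_integral_real_affine[of "sgn (c - x)" "\<lambda>t. indicator A t *\<^sub>R h t" x]
    by (simp add: sgn_if)
  have ind: "indicator {min c x<..<max c x} (x + sgn (c - x) * s)
      = (indicator {0<..<\<bar>x - c\<bar>} s :: real)" for s
    using assms by (auto simp: indicator_def sgn_if)
  have "(LBINT t=c..x. h t) = - sgn (c - x) * (LBINT t. indicator {min c x<..<max c x} t *\<^sub>R h t)"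
    using assms
    by (auto simp: interval_lebesgue_integral_def set_lebesgue_integral_def sgn_if min_def max_def)
  also have "\<dots> = - sgn (c - x) * (LBINT s=0..ereal \<bar>x - c\<bar>. h (x + sgn (c - x) * s))"
    unfolding sub ind
    by (simp add: interval_lebesgue_integral_def set_lebesgue_integral_def zero_ereal_def)
  finally show ?thesis .
qed

theorem corollary3p9:
  fixes f :: "real \<Rightarrow> real" and \<alpha> p \<mu> :: real
  assumes "f C1_differentiable_on UNIV"
    and "0 < \<alpha>" and "\<alpha> \<le> 1" and "p > 0" and "\<mu> > 0"
    and "uniformly_convex \<mu> p f"
  shows "\<forall>x c :: real. x \<noteq> c \<longrightarrow>
    deriv f x * (x - c) / (Gamma (2 - \<alpha>) * \<bar>x - c\<bar> powr \<alpha>) - caputo_deriv \<alpha> c f x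
      \<ge> \<mu> * rGamma (1 - \<alpha>) / (1 + p - \<alpha>) * \<bar>x - c\<bar> powr (1 + p - \<alpha>)"
proof (intro allI impI)
  fix x c :: real
  assume "x \<noteq> c"
  obtain D where D: "\<And>t. (f has_vector_derivative D t) (at t)" and "continuous_on UNIV D"
    using assms(1) unfolding C1_differentiable_on_def by auto
  have "deriv f = D"
    using D by (auto intro!: DERIV_imp_deriv simp: has_real_derivative_iff_has_vector_derivative)
  then have df: "(f has_real_derivative deriv f t) (at t)" for t
    using D by (simp add: has_real_derivative_iff_has_vector_derivative)
  have cdf: "continuous_on A (deriv f)" for A
    using \<open>continuous_on UNIV D\<close> \<open>deriv f = D\<close> continuous_on_subset by blast
  show "deriv f x * (x - c) / (Gamma (2 - \<alpha>) * \<bar>x - c\<bar> powr \<alpha>) - caputo_deriv \<alpha> c f x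
      \<ge> \<mu> * rGamma (1 - \<alpha>) / (1 + p - \<alpha>) * \<bar>x - c\<bar> powr (1 + p - \<alpha>)"
  proof (cases "\<alpha> = 1")
    case True
    then show ?thesis
      using \<open>x \<noteq> c\<close> by (simp add: caputo_deriv_def real_sgn_eq)
  next
    case False
    with \<open>\<alpha> \<le> 1\<close> have "\<alpha> < 1" by simp
    define L where "L = \<bar>x - c\<bar>"
    define \<sigma> where "\<sigma> = sgn (c - x)"
    define g where "g s = f (x + \<sigma> * s) - f x - \<sigma> * deriv f x * s" for s
    define g' where "g' s = \<sigma> * deriv f (x + \<sigma> * s) - \<sigma> * deriv f x" for s
    have "0 < L" and \<sigma>: "\<bar>\<sigma>\<bar> = 1" and xc: "x - c = - \<sigma> * L"
      using \<open>x \<noteq> c\<close> by (auto simp: L_def \<sigma>_def sgn_if)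
    define J where "J = integral {0..L} (\<lambda>s. deriv f (x + \<sigma> * s) * s powr - \<alpha>)"
    have cont_ray: "continuous_on {0..L} (\<lambda>s. deriv f (x + \<sigma> * s))"
      by (intro continuous_on_compose2[OF cdf[of UNIV]] continuous_intros) auto
    note int_ray = weakly_singular_set_integrable[OF cont_ray \<open>\<alpha> < 1\<close> less_imp_le[OF \<open>0 < L\<close>]]

    have caputo: "caputo_deriv \<alpha> c f x = - \<sigma> * rGamma (1 - \<alpha>) * J"
    proof -
      have "(LBINT t=c..x. deriv f t / \<bar>x - t\<bar> powr \<alpha>)
          = - \<sigma> * (LBINT s=0..L. deriv f (x + \<sigma> * s) / \<bar>x - (x + \<sigma> * s)\<bar> powr \<alpha>)"
        unfolding \<sigma>_def L_def by (rule oriented_integral_from_endpoint[OF \<open>x \<noteq> c\<close>])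
      also have "(LBINT s=0..L. deriv f (x + \<sigma> * s) / \<bar>x - (x + \<sigma> * s)\<bar> powr \<alpha>)
          = (LBINT s=0..L. deriv f (x + \<sigma> * s) * s powr - \<alpha>)"
        using \<open>0 < L\<close> \<sigma>
        by (intro interval_integral_cong)
           (auto simp: abs_mult powr_minus divide_inverse zero_ereal_def min_def max_def)
      also have "\<dots> = J"
        using interval_integral_eq_integral[of 0 L] int_ray \<open>0 < L\<close>
        by (simp add: J_def zero_ereal_def)
      finally show ?thesis
        using False by (simp add: caputo_deriv_def)
    qed

    have kernel: "((\<lambda>s. s powr - \<alpha>) has_integral L powr (1 - \<alpha>) / (1 - \<alpha>)) {0..L}"
      using has_integral_powr_from_0[of "- \<alpha>" L] \<open>\<alpha> < 1\<close> \<open>0 < L\<close> by simp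
    have "((\<lambda>s. deriv f (x + \<sigma> * s) * s powr - \<alpha>) has_integral J) {0..L}"
      unfolding J_def by (intro integrable_integral set_borel_integral_eq_integral(1) int_ray)
    from has_integral_diff[OF has_integral_mult_right[OF this, of \<sigma>]
        has_integral_mult_right[OF kernel, of "\<sigma> * deriv f x"]]
    have int_g': "integral {0..L} (\<lambda>s. g' s * s powr - \<alpha>)
        = \<sigma> * J - \<sigma> * deriv f x * (L powr (1 - \<alpha>) / (1 - \<alpha>))"
      by (intro integral_unique) (simp add: g'_def algebra_simps)

    have "\<mu> / (1 + p) * (1 + p) / (1 + p - \<alpha>) * L powr (1 + p - \<alpha>)
        \<le> integral {0..L} (\<lambda>s. g' s * s powr - \<alpha>)"
    proof (rule weakly_singular_integral_lower_bound[where g = g])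
      show "(g has_real_derivative g' s) (at s within {0..L})" for s
        unfolding g_def g'_def
        by (rule has_field_derivative_at_within)
           (auto intro!: derivative_eq_intros DERIV_chain2[OF df])
      show "continuous_on {0..L} g'"
        unfolding g'_def by (intro continuous_intros cont_ray)
      show "\<mu> / (1 + p) * s powr (1 + p) \<le> g s" if "s \<in> {0..L}" for s
      proof -
        have "\<mu> / (1 + p) * \<bar>x + \<sigma> * s - x\<bar> powr (1 + p)
            \<le> f (x + \<sigma> * s) - f x - deriv f x * (x + \<sigma> * s - x)"
          using assms(6) unfolding uniformly_convex_def by blast
        then show ?thesis
          using that \<sigma> by (simp add: g_def abs_mult mult_ac)
      qed
    qed (use assms \<open>\<alpha> < 1\<close> \<open>0 < L\<close> in \<open>auto simp: g_def\<close>)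
    then have bound: "\<mu> / (1 + p - \<alpha>) * L powr (1 + p - \<alpha>)
        \<le> \<sigma> * J - \<sigma> * deriv f x * (L powr (1 - \<alpha>) / (1 - \<alpha>))"
      using int_g' \<open>p > 0\<close> by simp

    have Gamma_pos: "0 < Gamma (1 - \<alpha>)"
      using \<open>\<alpha> < 1\<close> by (intro Gamma_real_pos) simp
    have "Gamma (2 - \<alpha>) = (1 - \<alpha>) * Gamma (1 - \<alpha>)"
      using Gamma_plus1[of "1 - \<alpha>"] \<open>\<alpha> < 1\<close> nonpos_Ints_nonpos[of "1 - \<alpha>"] by force
    then have "deriv f x * (x - c) / (Gamma (2 - \<alpha>) * L powr \<alpha>)
        = rGamma (1 - \<alpha>) * (- \<sigma> * deriv f x * (L powr (1 - \<alpha>) / (1 - \<alpha>)))"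
      using \<open>0 < L\<close> Gamma_pos \<open>\<alpha> < 1\<close>
      by (simp add: xc rGamma_inverse_Gamma powr_diff divide_simps)
    with caputo have "deriv f x * (x - c) / (Gamma (2 - \<alpha>) * L powr \<alpha>) - caputo_deriv \<alpha> c f x
        = rGamma (1 - \<alpha>) * (\<sigma> * J - \<sigma> * deriv f x * (L powr (1 - \<alpha>) / (1 - \<alpha>)))"
      by (simp add: algebra_simps)
    also have "\<dots> \<ge> rGamma (1 - \<alpha>) * (\<mu> / (1 + p - \<alpha>) * L powr (1 + p - \<alpha>))"
      using bound Gamma_pos by (intro mult_left_mono) (auto simp: rGamma_inverse_Gamma)
    finally show ?thesis
      by (simp add: L_def mult_ac)
  qed
qed

end
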